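(* Suppose that the sample space $\Omega$ is a finite set. Let $F:\mathcal{L}^2(\Omega,\mathscr{F},R^n)\to\mathcal{L}^2(\Omega,\mathscr{F},R^n)$ be monotone and Lipschitz continuous with constant $L_F>0$ (with respect to $\|\cdot\|_{\mathcal{L}^2}$), and assume that the solution set of the variational inequality $\mathrm{VI}(T,\mathcal{K})$ is nonempty. Let $\beta>0$, $r>\frac{L_F}{\beta}+1$ and $\alpha\in(0,1)$. Then the sequence $\{\theta^k\}_{k=0}^\infty=\{(x^k,y^k,\lambda^k)^\top\}_{k=0}^\infty$ generated by the prediction-correction ADMM from any starting point $\theta^0\in\mathcal{C}\times\mathcal{N}\times\mathcal{L}^2(\Omega,\mathscr{F},R^n)$ converges (in norm) to some solution $\theta^*$ of $\mathrm{VI}(T,\mathcal{K})$. Consequently, the sequence $\{x^k\}_{k=0}^\infty$ converges to a solution $x^*$ of the multistage stochastic variational inequality $\mathrm{MSVI}(F,\mathcal{C}\cap\mathcal{N})$, i.e. to some $x^*\in\mathcal{C}\cap\mathcal{N}$ with $-F(x^* )\in N_{\mathcal{C}\cap\mathcal{N}}(x^* )$.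
   Context: Let $\Omega=\{\omega_1,\dots,\omega_m\}$ be a finite set, $\mathscr{F}=2^{\Omega}$ the $\sigma$-field of all its subsets, and $P$ the probability measure with $P(\{\omega_i\})=p_i>0$, $\sum_{i=1}^m p_i=1$. $\mathcal{L}^2(\Omega,\mathscr{F},R^n)$ is the (finite dimensional) Hilbert space of maps $\Omega\to R^n$ with inner product $\langle\xi,\eta\rangle_{\mathcal{L}^2}=\mathbb{E}\langle\xi,\eta\rangle=\sum_{i=1}^m p_i\langle\xi(\omega_i),\eta(\omega_i)\rangle$ and norm $\|\xi\|_{\mathcal{L}^2}$. Let $N\in\mathbb{N}$, let $\xi_j$ be $R^{m_j}$-valued random vectors on $\Omega$ ($j=1,\dots,N-1$), put $\mathscr{F}_0=\{\emptyset,\Omega\}$ and, for $1\le i\le N-1$, let $\mathscr{F}_i$ be the $\sigma$-field generated by $\xi_1,\dots,\xi_i$. Let $n_0+\cdots+n_{N-1}=n$ with $n_i\in\mathbb{N}$, and write $x=(x_0,\dots,x_{N-1})$ with $x_i$ valued in $R^{n_i}$. The nonanticipativity subspace is $\mathcal{N}=\{x\in\mathcal{L}^2(\Omega,\mathscr{F},R^n): x_i \text{ is } \mathscr{F}_i\text{-measurable},\ i=0,\dots,N-1\}$. Let $C_i:\Omega\rightsquigarrow R^{n_i}$ be $\mathscr{F}_i$-measurable set-valued maps with nonempty closed convex values, $i=0,\dots,N-1$ (measurable means $\{\omega: C_i(\omega)\cap A\ne\emptyset\}\in\mathscr{F}_i$ for every Borel $A\subset R^{n_i}$), and let $\mathcal{C}=\{x\in\mathcal{L}^2(\Omega,\mathscr{F},R^n):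 x_i(\omega)\in C_i(\omega)\text{ for all }\omega\in\Omega,\ i=0,\dots,N-1\}$, a closed convex set. For a nonempty closed convex $\mathcal{S}\subset\mathcal{L}^2(\Omega,\mathscr{F},R^n)$ and $x\in\mathcal{S}$, $N_{\mathcal{S}}(x)=\{v: \langle v,y-x\rangle_{\mathcal{L}^2}\le0\ \forall y\in\mathcal{S}\}$ is the normal cone, and $\Pi_{\mathcal{S}}$ denotes the metric projection onto $\mathcal{S}$ with respect to $\|\cdot\|_{\mathcal{L}^2}$. Let $\mathcal{K}=\mathcal{C}\times\mathcal{N}\times\mathcal{L}^2(\Omega,\mathscr{F},R^n)$ and, for $\theta=(x,y,\lambda)^\top\in[\mathcal{L}^2(\Omega,\mathscr{F},R^n)]^3$, let $T(\theta)=(F(x)-\lambda,\ \lambda,\ x-y)^\top$. $\mathrm{VI}(T,\mathcal{K})$ is the problem of finding $\theta^*\in\mathcal{K}$ such that $\langle T(\theta^* ),\theta-\theta^*\rangle_{\mathcal{L}^2}\ge 0$ for all $\theta\in\mathcal{K}$ (inner product on the product space, i.e. the sum of the componentwise inner products). $F$ is monotone if $\langle F(x)-F(y),x-y\rangle_{\mathcal{L}^2}\ge0$ for all $x,y$. Prediction-correction ADMM. Given $\beta,r>0$ with $r>\frac{L_F}{\beta}+1$, $\alpha\in(0,1)$ and $\theta^0=(x^0,y^0,\lambda^0)^\top\in\mathcal{C}\times\mathcal{N}\times\mathcal{L}^2(\Omega,\mathscr{F},R^n)$, for $k=0,1,2,\dots$ and $\theta^k=(x^k,y^k,\lambda^k)^\top$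 compute the prediction $\tilde\theta^k=(\tilde x^k,\tilde y^k,\tilde\lambda^k)^\top$ by $$\tilde x^k=\Pi_{\mathcal{C}}\{x^k-\tfrac{1}{\beta r}[F(x^k)-\lambda^k+\beta(x^k-y^k)]\},$$ $$\tilde y^k=\Pi_{\mathcal{N}}\{y^k-\tfrac1\beta[\lambda^k-\beta(\tilde x^k-y^k)]\},\qquad \tilde\lambda^k=\lambda^k-\beta(\tilde x^k-\tilde y^k),$$ and then the correction $\theta^{k+1}=\theta^k-\alpha\, d(\theta^k,\tilde\theta^k,\zeta^k)$, where $\zeta^k=(\zeta_x^k,0,0)^\top$, $\zeta_x^k=F(x^k)-F(\tilde x^k)+\beta(x^k-\tilde x^k)$, $d(\theta^k,\tilde\theta^k,\zeta^k)=\theta^k-\tilde\theta^k-G^{-1}\zeta^k$, and $G(x,y,\lambda)^\top=(\beta r x,\ \beta y,\ \tfrac1\beta\lambda)^\top$ (so $G^{-1}(u,v,w)^\top=(\tfrac{1}{\beta r}u,\tfrac1\beta v,\beta w)^\top$). *)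

theory Defs
  imports "HOL-Probability.Probability"
begin

text \<open>
  The sample space is a finite type, carrying the power set as its sigma-field; the probability
  measure is a \<^typ>\<open>'w pmf\<close> (assumed positive at every point in the theorem).
  A random vector \<open>x\<close> with values in \<open>R^n\<close> is an element of \<open>real^'n^'w\<close>, with value
  \<open>x $ \<omega>\<close> at \<open>\<omega>\<close>. Only the vector space structure of this type is used: the built-in inner
  product and norm are unweighted, so those of the space \<open>L^2\<close> are defined here.
\<close>

definition L2_inner :: "'w::finite pmf \<Rightarrow> real^'n^'w \<Rightarrow> real^'n^'w \<Rightarrow> real" where
  "L2_inner P \<xi> \<eta> = measure_pmf.expectation P (\<lambda>\<omega>. \<xi> $ \<omega> \<bullet> \<eta> $ \<omega>)"

definition L2_norm :: "'w::finite pmf \<Rightarrow> real^'n^'w \<Rightarrow> real" where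
  "L2_norm P \<xi> = sqrt (L2_inner P \<xi> \<xi>)"

type_synonym ('n, 'w) triple = "(real^'n^'w) \<times> (real^'n^'w) \<times> (real^'n^'w)"

definition L2_inner3 :: "'w::finite pmf \<Rightarrow> ('n::finite, 'w) triple \<Rightarrow> ('n, 'w) triple \<Rightarrow> real" where
  "L2_inner3 P = (\<lambda>(x, y, l) (x', y', l'). L2_inner P x x' + L2_inner P y y' + L2_inner P l l')"

definition L2_norm3 :: "'w::finite pmf \<Rightarrow> ('n::finite, 'w) triple \<Rightarrow> real" where
  "L2_norm3 P \<theta> = sqrt (L2_inner3 P \<theta> \<theta>)"

definition L2_monotone :: "'w::finite pmf \<Rightarrow> (real^'n^'w \<Rightarrow> real^'n^'w) \<Rightarrow> bool" where
  "L2_monotone P F \<longleftrightarrow> (\<forall>x y. 0 \<le> L2_inner P (F x - F y) (x - y))"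

definition L2_lipschitz :: "'w::finite pmf \<Rightarrow> real \<Rightarrow> (real^'n^'w \<Rightarrow> real^'n^'w) \<Rightarrow> bool" where
  "L2_lipschitz P L F \<longleftrightarrow> (\<forall>x y. L2_norm P (F x - F y) \<le> L * L2_norm P (x - y))"

definition normal_cone :: "'w::finite pmf \<Rightarrow> (real^'n^'w) set \<Rightarrow> real^'n^'w \<Rightarrow> (real^'n^'w) set" where
  "normal_cone P S x = {v. \<forall>y\<in>S. L2_inner P v (y - x) \<le> 0}"

text \<open>
  The counterpart of \<^const>\<open>closest_point\<close> for the weighted norm; the choice is unique
  when \<open>S\<close> is nonempty, closed and convex and \<open>P\<close> is positive everywhere.
\<close>

definition L2_proj :: "'w::finite pmf \<Rightarrow> (real^'n^'w) set \<Rightarrow> real^'n^'w \<Rightarrow> real^'n^'w" where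
  "L2_proj P S u = (SOME z. z \<in> S \<and> (\<forall>y\<in>S. L2_norm P (u - z) \<le> L2_norm P (u - y)))"

text \<open>
  The splitting \<open>n = n_0 + ... + n_{N-1}\<close> is given by a map \<open>stage\<close> that assigns to each
  coordinate in \<open>'n\<close> the stage it belongs to, so that \<open>n_i = card {j. stage j = i}\<close>.
  The space \<open>R^{n_i}\<close> is identified with the subspace of \<open>real^'n\<close> of vectors vanishing
  outside the coordinates of stage \<open>i\<close>, and \<open>x_i\<close> with the projection of \<open>x\<close> to it.
  On this subspace the topology and the Borel sets are those induced from \<open>real^'n\<close>.
\<close>

definition block_space :: "('n::finite \<Rightarrow> nat) \<Rightarrow> nat \<Rightarrow> (real^'n) set" where
  "block_space stage i = {v. \<forall>j. stage j \<noteq> i \<longrightarrow> v $ j = 0}"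

definition block :: "('n::finite \<Rightarrow> nat) \<Rightarrow> nat \<Rightarrow> real^'n \<Rightarrow> real^'n" where
  "block stage i v = (\<chi> j. if stage j = i then v $ j else 0)"

text \<open>
  \<open>R^{m_j}\<close>, with its Borel sets, is the product space over the index set \<open>{..<m j}\<close>.
  For \<open>i = 0\<close> the generator is empty, which gives the trivial sigma-field.
\<close>

definition filtr :: "(nat \<Rightarrow> nat) \<Rightarrow> (nat \<Rightarrow> 'w \<Rightarrow> nat \<Rightarrow> real) \<Rightarrow> nat \<Rightarrow> 'w measure" where
  "filtr m \<xi> i = sigma UNIV
     (\<Union>j\<in>{1..i}. {\<xi> j -` A | A. A \<in> sets (\<Pi>\<^sub>M l\<in>{..<m j}. (borel :: real measure))})"

definition measurable_setmap :: "'w measure \<Rightarrow> ('w \<Rightarrow> 'b::topological_space set) \<Rightarrow> bool" where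
  "measurable_setmap M S \<longleftrightarrow> (\<forall>A\<in>sets borel. {\<omega>\<in>space M. S \<omega> \<inter> A \<noteq> {}} \<in> sets M)"

definition nonanticip ::
  "(nat \<Rightarrow> nat) \<Rightarrow> (nat \<Rightarrow> 'w \<Rightarrow> nat \<Rightarrow> real) \<Rightarrow> nat \<Rightarrow> ('n::finite \<Rightarrow> nat) \<Rightarrow> (real^'n^'w::finite) set"
  where
  "nonanticip m \<xi> N stage =
     {x. \<forall>i<N. (\<lambda>\<omega>. block stage i (x $ \<omega>)) \<in> borel_measurable (filtr m \<xi> i)}"

definition constr ::
  "(nat \<Rightarrow> 'w \<Rightarrow> (real^'n) set) \<Rightarrow> nat \<Rightarrow> ('n::finite \<Rightarrow> nat) \<Rightarrow> (real^'n^'w::finite) set" where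
  "constr C N stage = {x. \<forall>\<omega>. \<forall>i<N. block stage i (x $ \<omega>) \<in> C i \<omega>}"

definition MSVI_solution ::
  "'w::finite pmf \<Rightarrow> (real^'n^'w \<Rightarrow> real^'n^'w) \<Rightarrow> (real^'n^'w) set \<Rightarrow> real^'n^'w \<Rightarrow> bool" where
  "MSVI_solution P F S x \<longleftrightarrow> x \<in> S \<and> - F x \<in> normal_cone P S x"

definition T_op :: "(real^'n^'w \<Rightarrow> real^'n^'w) \<Rightarrow> ('n::finite, 'w::finite) triple \<Rightarrow> ('n, 'w) triple" where
  "T_op F = (\<lambda>(x, y, l). (F x - l, l, x - y))"

definition VI_solution ::
  "'w::finite pmf \<Rightarrow> (('n::finite, 'w) triple \<Rightarrow> ('n, 'w) triple) \<Rightarrow> ('n, 'w) triple set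
    \<Rightarrow> ('n, 'w) triple \<Rightarrow> bool" where
  "VI_solution P T K \<theta> \<longleftrightarrow> \<theta> \<in> K \<and> (\<forall>\<theta>'\<in>K. 0 \<le> L2_inner3 P (T \<theta>) (\<theta>' - \<theta>))"

definition G_op :: "real \<Rightarrow> real \<Rightarrow> ('n::finite, 'w::finite) triple \<Rightarrow> ('n, 'w) triple" where
  "G_op \<beta> r = (\<lambda>(x, y, l). ((\<beta> * r) *\<^sub>R x, \<beta> *\<^sub>R y, (1 / \<beta>) *\<^sub>R l))"

definition prediction ::
  "'w::finite pmf \<Rightarrow> (real^'n^'w \<Rightarrow> real^'n^'w) \<Rightarrow> (real^'n^'w) set \<Rightarrow> (real^'n^'w) set
    \<Rightarrow> real \<Rightarrow> real \<Rightarrow> ('n::finite, 'w) triple \<Rightarrow> ('n, 'w) triple" where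
  "prediction P F CC NN \<beta> r = (\<lambda>(x, y, l).
     let xt = L2_proj P CC (x - (1 / (\<beta> * r)) *\<^sub>R (F x - l + \<beta> *\<^sub>R (x - y)));
         yt = L2_proj P NN (y - (1 / \<beta>) *\<^sub>R (l - \<beta> *\<^sub>R (xt - y)));
         lt = l - \<beta> *\<^sub>R (xt - yt)
     in (xt, yt, lt))"

definition zeta ::
  "(real^'n^'w \<Rightarrow> real^'n^'w) \<Rightarrow> real \<Rightarrow> ('n::finite, 'w::finite) triple \<Rightarrow> ('n, 'w) triple
    \<Rightarrow> ('n, 'w) triple" where
  "zeta F \<beta> \<theta> \<theta>t = (F (fst \<theta>) - F (fst \<theta>t) + \<beta> *\<^sub>R (fst \<theta> - fst \<theta>t), 0, 0)"

definition direction ::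
  "real \<Rightarrow> real \<Rightarrow> ('n::finite, 'w::finite) triple \<Rightarrow> ('n, 'w) triple \<Rightarrow> ('n, 'w) triple
    \<Rightarrow> ('n, 'w) triple" where
  "direction \<beta> r \<theta> \<theta>t \<zeta> = \<theta> - \<theta>t - inv (G_op \<beta> r) \<zeta>"

definition PC_ADMM_step ::
  "'w::finite pmf \<Rightarrow> (real^'n^'w \<Rightarrow> real^'n^'w) \<Rightarrow> (real^'n^'w) set \<Rightarrow> (real^'n^'w) set
    \<Rightarrow> real \<Rightarrow> real \<Rightarrow> real \<Rightarrow> ('n::finite, 'w) triple \<Rightarrow> ('n, 'w) triple" where
  "PC_ADMM_step P F CC NN \<beta> r \<alpha> \<theta> =
     (let \<theta>t = prediction P F CC NN \<beta> r \<theta>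
      in \<theta> - \<alpha> *\<^sub>R direction \<beta> r \<theta> \<theta>t (zeta F \<beta> \<theta> \<theta>t))"

end

theory Submission imports Defs begin

text \<open>
  In the metric of \<open>G\<close>, the correction is a relaxed step along a direction that makes an acute
  angle with \<open>\<theta>\<^sup>k - \<theta>\<^sup>*\<close>: the projections satisfy variational inequalities, \<open>T\<close> is
  monotone, and \<open>r > L\<^sub>F / \<beta> + 1\<close> makes \<open>G\<^sup>-\<^sup>1 \<zeta>\<^sup>k\<close> shorter than the prediction gap. Hence the
  \<open>G\<close>-distance to every solution decreases by a multiple of the squared gap, up to an error coming
  from the component of \<open>\<lambda>\<^sup>k\<close> in the nonanticipativity subspace, which decays like \<open>(1 - \<alpha>)\<^sup>k\<close> and
  is absorbed into the Lyapunov function. So the gap tends to zero, an accumulation point of the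
  bounded iterates is a solution, and monotonicity of the Lyapunov function for this very solution
  gives convergence of the whole sequence.
\<close>

section \<open>The relaxed step and the abstract scheme\<close>

text \<open>Expanding both sides, \<open>D\<close> cancels and only
  \<open>\<alpha> * \<alpha> \<le> \<alpha>\<close> remains. The free vector \<open>D\<close> later
  stands for the prediction gap: then \<open>e - D\<close> is the predicted point relative to a
  solution, where the variational inequalities live, and \<open>d - D\<close> is the correction term
  alone.\<close>

lemma relaxed_step_norm:
  fixes e d D :: "'a::real_inner"
  assumes "0 \<le> \<alpha>" "\<alpha> \<le> 1"
  shows "(norm (e - \<alpha> *\<^sub>R d))\<^sup>2
    \<le> (norm e)\<^sup>2 - 2 * \<alpha> * (d \<bullet> (e - D)) + \<alpha> * ((norm (d - D))\<^sup>2 - (norm D)\<^sup>2)"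
proof -
  have "\<alpha> * \<alpha> * (d \<bullet> d) \<le> \<alpha> * (d \<bullet> d)"
    using assms by (intro mult_right_mono) (auto simp: mult_left_le)
  then show ?thesis
    unfolding power2_norm_eq_inner
    by (simp add: inner_diff_left inner_diff_right inner_commute algebra_simps)
qed

text \<open>
  Here \<open>s\<close> is \<open>\<beta> r\<close>, and \<open>X\<close>, \<open>Y\<close> are the predictions; the projections enter only through their
  variational inequalities.
\<close>

locale pc_admm =
  fixes C N :: "'a::euclidean_space set" and F :: "'a \<Rightarrow> 'a"
    and L \<beta> s \<alpha> :: real
    and x y l X Y :: "nat \<Rightarrow> 'a"
  assumes closed_C: "closed C" and subspace_N: "subspace N"
    and mono: "\<And>a b. 0 \<le> (F a - F b) \<bullet> (a - b)"
    and lipschitz: "\<And>a b. norm (F a - F b) \<le> L * norm (a - b)"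
    and L_nonneg: "0 \<le> L" and beta_pos: "0 < \<beta>" and s_large: "L + \<beta> < s"
    and alpha: "0 < \<alpha>" "\<alpha> < 1"
    and y_0: "y 0 \<in> N" and X_in: "\<And>k. X k \<in> C" and Y_in: "\<And>k. Y k \<in> N"
    and X_var: "\<And>k a. a \<in> C \<Longrightarrow>
      0 \<le> (s *\<^sub>R (X k - x k) + (F (x k) - l k + \<beta> *\<^sub>R (x k - y k))) \<bullet> (a - X k)"
    and Y_var: "\<And>k b. b \<in> N \<Longrightarrow> 0 \<le> (l k - \<beta> *\<^sub>R (X k - Y k)) \<bullet> (b - Y k)"
    and x_Suc: "\<And>k. x (Suc k) =
      x k - \<alpha> *\<^sub>R (x k - X k - (1 / s) *\<^sub>R (F (x k) - F (X k) + \<beta> *\<^sub>R (x k - X k)))"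
    and y_Suc: "\<And>k. y (Suc k) = y k - \<alpha> *\<^sub>R (y k - Y k)"
    and l_Suc: "\<And>k. l (Suc k) = l k - \<alpha> *\<^sub>R (\<beta> *\<^sub>R (X k - Y k))"
begin

text \<open>The variational inequality on the product set with its unconstrained third component
  solved: both primal components equal \<open>a\<close>, and \<open>c\<close> is the multiplier of
  the constraint that they agree.\<close>

definition multiplier_solution :: "'a \<Rightarrow> 'a \<Rightarrow> bool" where
  "multiplier_solution a c \<longleftrightarrow>
     a \<in> C \<and> a \<in> N \<and> (\<forall>a'\<in>C. 0 \<le> (F a - c) \<bullet> (a' - a)) \<and> (\<forall>b\<in>N. 0 \<le> c \<bullet> (b - a))"

text \<open>The predicted multiplier, that is, the third component of the prediction.\<close>

definition multiplier :: "nat \<Rightarrow> 'a" where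
  "multiplier k = l k - \<beta> *\<^sub>R (X k - Y k)"

text \<open>The first coefficient is what is left of \<open>s\<close> after subtracting the bound
  for the correction term. The second is \<open>\<beta> / 2\<close> instead of
  \<open>\<beta>\<close> because the other half absorbs the cross term with the
  \<open>N\<close>-component of \<open>l k\<close>.\<close>

definition gap :: "nat \<Rightarrow> real" where
  "gap k = (s - (L + \<beta>)\<^sup>2 / s) * (norm (x k - X k))\<^sup>2 + \<beta> / 2 * (norm (y k - Y k))\<^sup>2
     + 1 / \<beta> * (norm (l k - multiplier k))\<^sup>2"

definition dist_G :: "'a \<Rightarrow> 'a \<Rightarrow> nat \<Rightarrow> real" where
  "dist_G a c k = s * (norm (x k - a))\<^sup>2 + \<beta> * (norm (y k - a))\<^sup>2 + 1 / \<beta> * (norm (l k - c))\<^sup>2"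

lemma s_pos: "0 < s"
  using s_large L_nonneg beta_pos by linarith

text \<open>This is where the lower bound on \<open>s\<close>, hence on \<open>r\<close>, enters the
  convergence argument.\<close>

lemma gap_coeff_pos: "0 < s - (L + \<beta>)\<^sup>2 / s"
proof -
  have "(L + \<beta>)\<^sup>2 < s\<^sup>2"
    using s_large L_nonneg beta_pos by (intro power_strict_mono) auto
  then show ?thesis using s_pos by (simp add: field_simps power2_eq_square)
qed

section \<open>Orthogonality to the subspace and the Fejer estimate\<close>

lemma y_in: "y k \<in> N"
proof (induction k)
  case (Suc k)
  then show ?case unfolding y_Suc
    by (intro subspace_diff subspace_scale subspace_N Y_in)
qed (rule y_0)

text \<open>On a subspace a variational inequality is an equation: test with \<open>Y k + b\<close>
  and \<open>Y k - b\<close>.\<close>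

lemma multiplier_orth: assumes "b \<in> N" shows "multiplier k \<bullet> b = 0"
  using Y_var[of "Y k + b" k] Y_var[of "Y k - b" k]
    subspace_add[OF subspace_N Y_in assms] subspace_diff[OF subspace_N Y_in assms]
  by (auto simp: multiplier_def intro: antisym)

text \<open>
  The initial multiplier need not be orthogonal to \<open>N\<close>; its component in \<open>N\<close> perturbs the Fejer estimate.
\<close>

lemma l_mod_orth:
  obtains p where "\<And>k b. b \<in> N \<Longrightarrow> (l k - (1 - \<alpha>) ^ k *\<^sub>R p) \<bullet> b = 0"
proof -
  obtain p q where p: "p \<in> span N" "\<And>b. b \<in> span N \<Longrightarrow> orthogonal q b" "l 0 = p + q"
    using orthogonal_subspace_decomp_exists by metis
  have "(l k - (1 - \<alpha>) ^ k *\<^sub>R p) \<bullet> b = 0" if b: "b \<in> N" for k b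
  proof (induction k)
    case 0
    then show ?case using p(2)[OF span_base[OF b]] p(3) by (simp add: orthogonal_def)
  next
    case (Suc k)
    \<comment> \<open>The new \<open>l\<close> is a convex combination of the old one and a vector
      orthogonal to \<open>N\<close>, so its component in \<open>N\<close> shrinks by the factor
      \<open>1 - \<alpha>\<close>.\<close>
    have "l (Suc k) - (1 - \<alpha>) ^ Suc k *\<^sub>R p
      = (1 - \<alpha>) *\<^sub>R (l k - (1 - \<alpha>) ^ k *\<^sub>R p) + \<alpha> *\<^sub>R multiplier k"
      unfolding l_Suc multiplier_def by (simp add: algebra_simps)
    then show ?case using Suc multiplier_orth[OF b] by (simp add: inner_left_distrib)
  qed
  then show thesis using that by blast
qed

lemma l_Suc_multiplier: "l (Suc k) = l k - \<alpha> *\<^sub>R (l k - multiplier k)"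
  unfolding l_Suc multiplier_def by simp

text \<open>The same vector as in \<open>X_var\<close>, regrouped around the predicted point: the
  operator there, minus \<open>s\<close> times the correction direction in \<open>x\<close>, minus a
  cross term in \<open>y\<close>.\<close>

lemma X_var':
  assumes "a \<in> C"
  shows "0 \<le> (F (X k) - multiplier k - (s *\<^sub>R (x k - X k) - (F (x k) - F (X k) + \<beta> *\<^sub>R (x k - X k)))
    - \<beta> *\<^sub>R (y k - Y k)) \<bullet> (a - X k)"
  using X_var[OF assms, of k] unfolding multiplier_def by (simp add: algebra_simps)

text \<open>Adding the projection inequality at \<open>X k\<close>, monotonicity of \<open>F\<close>
  and the inequalities of the solution bounds from below the inner product of the direction with the
  predicted error, up to \<open>v \<bullet> p\<close>. Three relaxed steps, weighted as in
  \<open>dist_G\<close>, turn this bound into a decrease.\<close>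

lemma fejer:
  assumes sol: "multiplier_solution a c"
    and p: "\<And>b. b \<in> N \<Longrightarrow> (l k - p) \<bullet> b = 0"
  shows "dist_G a c (Suc k) \<le> dist_G a c k - \<alpha> * gap k + 2 * \<alpha> / \<beta> * (norm p)\<^sup>2"
proof -
  define u v w z where "u = x k - X k" and "v = y k - Y k" and "w = l k - multiplier k"
    and "z = F (x k) - F (X k) + \<beta> *\<^sub>R (x k - X k)"
  have w: "w = \<beta> *\<^sub>R (X k - Y k)" by (simp add: w_def multiplier_def)
  have aC: "a \<in> C" and aN: "a \<in> N" using sol by (auto simp: multiplier_solution_def)
  have sol1: "0 \<le> (F a - c) \<bullet> (X k - a)" and sol2: "0 \<le> c \<bullet> (Y k - a)"
    using sol X_in Y_in by (auto simp: multiplier_solution_def)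
  have vN: "v \<in> N" unfolding v_def by (intro subspace_diff subspace_N y_in Y_in)
  \<comment> \<open>Since \<open>v\<close> lies in \<open>N\<close>, the multiplier drops out of
    \<open>w\<close> and only the \<open>N\<close>-component of \<open>l k\<close> is seen; this is
    the sole perturbation of the estimate.\<close>
  have vw: "v \<bullet> w = v \<bullet> p"
    using p[OF vN] multiplier_orth[OF vN, of k] by (simp add: w_def inner_diff_left inner_diff_right inner_commute)
  have orth: "multiplier k \<bullet> (a - Y k) = 0"
    by (intro multiplier_orth subspace_diff subspace_N aN Y_in)
  have XY: "X k - Y k = (1 / \<beta>) *\<^sub>R w" using w beta_pos by simp
  have "0 \<le> (F (X k) - multiplier k - (s *\<^sub>R u - z) - \<beta> *\<^sub>R v) \<bullet> (a - X k)"
    using X_var'[OF aC, of k] by (simp add: u_def v_def z_def)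
  moreover have "0 \<le> (F (X k) - F a) \<bullet> (X k - a)" by (rule mono)
  moreover have "(X k - Y k) \<bullet> (c - multiplier k) = (1 / \<beta>) * (w \<bullet> (c - multiplier k))" by (simp add: XY)
  ultimately have "0 \<le> (s *\<^sub>R u - z) \<bullet> (X k - a) + \<beta> * (v \<bullet> (X k - a))
      + (1 / \<beta>) * (w \<bullet> (multiplier k - c))"
    using sol1 sol2 orth by (simp add: inner_diff_left inner_diff_right inner_commute algebra_simps)
  \<comment> \<open>The step in \<open>y\<close> needs the inner product at \<open>Y k\<close>, not
    at \<open>X k\<close>; the exchange costs \<open>v \<bullet> w\<close>, which is
    \<open>v \<bullet> p\<close>.\<close>
  moreover have "v \<bullet> (X k - a) = v \<bullet> (Y k - a) + (1 / \<beta>) * (v \<bullet> w)"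
  proof -
    have "X k - a = (Y k - a) + (X k - Y k)" by simp
    then show ?thesis by (metis XY inner_add_right inner_scaleR_right)
  qed
  ultimately have key: "0 \<le> (s *\<^sub>R u - z) \<bullet> (X k - a) + \<beta> * (v \<bullet> (Y k - a))
      + (1 / \<beta>) * (w \<bullet> (multiplier k - c)) + v \<bullet> p"
    using beta_pos vw by (simp add: algebra_simps)
  have x: "(norm (x (Suc k) - a))\<^sup>2 \<le> (norm (x k - a))\<^sup>2 - 2 * \<alpha> * ((u - (1 / s) *\<^sub>R z) \<bullet> (X k - a))
      + \<alpha> * ((norm ((1 / s) *\<^sub>R z))\<^sup>2 - (norm u)\<^sup>2)"
  proof -
    have eqs: "x (Suc k) - a = x k - a - \<alpha> *\<^sub>R (u - (1 / s) *\<^sub>R z)" "x k - a - u = X k - a"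
      "norm (u - (1 / s) *\<^sub>R z - u) = norm ((1 / s) *\<^sub>R z)"
      by (simp_all add: x_Suc u_def z_def)
    show ?thesis
      using relaxed_step_norm[OF less_imp_le[OF alpha(1)] less_imp_le[OF alpha(2)],
          of "x k - a" "u - (1 / s) *\<^sub>R z" u]
      unfolding eqs .
  qed
  have y: "(norm (y (Suc k) - a))\<^sup>2 \<le> (norm (y k - a))\<^sup>2 - 2 * \<alpha> * (v \<bullet> (Y k - a)) - \<alpha> * (norm v)\<^sup>2"
    using relaxed_step_norm[of \<alpha> "y k - a" v v] alpha
    by (simp add: y_Suc v_def algebra_simps)
  have l: "(norm (l (Suc k) - c))\<^sup>2 \<le> (norm (l k - c))\<^sup>2 - 2 * \<alpha> * (w \<bullet> (multiplier k - c)) - \<alpha> * (norm w)\<^sup>2"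
    using relaxed_step_norm[of \<alpha> "l k - c" w w] alpha
    by (simp add: l_Suc_multiplier w_def algebra_simps)
  have sz: "s * ((u - (1 / s) *\<^sub>R z) \<bullet> (X k - a)) = (s *\<^sub>R u - z) \<bullet> (X k - a)"
    using s_pos by (simp add: inner_diff_left algebra_simps)
  have "norm z \<le> norm (F (x k) - F (X k)) + norm (\<beta> *\<^sub>R u)"
    unfolding z_def u_def by (rule norm_triangle_ineq)
  also have "\<dots> \<le> L * norm u + \<beta> * norm u"
    unfolding u_def using lipschitz beta_pos by simp
  finally have "norm z \<le> L * norm u + \<beta> * norm u" .
  then have "(norm z)\<^sup>2 \<le> ((L + \<beta>) * norm u)\<^sup>2"
    by (intro power_mono) (auto simp: algebra_simps)
  then have z: "s * (norm ((1 / s) *\<^sub>R z))\<^sup>2 \<le> (L + \<beta>)\<^sup>2 / s * (norm u)\<^sup>2"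
    using s_pos by (simp add: power_mult_distrib power_divide power2_eq_square field_simps)
  \<comment> \<open>Young's inequality, weighted so that it consumes exactly the half of
    \<open>\<beta> * (norm v)\<^sup>2\<close> that \<open>gap\<close> leaves free.\<close>
  have "0 \<le> (norm (\<beta> *\<^sub>R v - 2 *\<^sub>R p))\<^sup>2" by simp
  also have "\<dots> = 2 * \<beta> * (\<beta> / 2 * (norm v)\<^sup>2 + 2 / \<beta> * (norm p)\<^sup>2 - 2 * (v \<bullet> p))"
    using beta_pos unfolding power2_norm_eq_inner
    by (simp add: inner_diff_left inner_diff_right inner_commute field_simps)
  finally have vp: "2 * (v \<bullet> p) \<le> \<beta> / 2 * (norm v)\<^sup>2 + 2 / \<beta> * (norm p)\<^sup>2"
    using beta_pos by (simp add: zero_le_mult_iff)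
  have "dist_G a c (Suc k) \<le>
      s * ((norm (x k - a))\<^sup>2 - 2 * \<alpha> * ((u - (1 / s) *\<^sub>R z) \<bullet> (X k - a))
        + \<alpha> * ((norm ((1 / s) *\<^sub>R z))\<^sup>2 - (norm u)\<^sup>2))
      + \<beta> * ((norm (y k - a))\<^sup>2 - 2 * \<alpha> * (v \<bullet> (Y k - a)) - \<alpha> * (norm v)\<^sup>2)
      + 1 / \<beta> * ((norm (l k - c))\<^sup>2 - 2 * \<alpha> * (w \<bullet> (multiplier k - c)) - \<alpha> * (norm w)\<^sup>2)"
    unfolding dist_G_def using x y l s_pos beta_pos
    by (intro add_mono mult_left_mono) auto
  also have "\<dots> = dist_G a c k
      - 2 * \<alpha> * (s * ((u - (1 / s) *\<^sub>R z) \<bullet> (X k - a)) + \<beta> * (v \<bullet> (Y k - a))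
          + (1 / \<beta>) * (w \<bullet> (multiplier k - c)))
      + \<alpha> * (s * (norm ((1 / s) *\<^sub>R z))\<^sup>2 - s * (norm u)\<^sup>2 - \<beta> * (norm v)\<^sup>2 - 1 / \<beta> * (norm w)\<^sup>2)"
    unfolding dist_G_def by (simp only: algebra_simps)
  also have "\<dots> \<le> dist_G a c k + 2 * \<alpha> * (v \<bullet> p)
      + \<alpha> * ((L + \<beta>)\<^sup>2 / s * (norm u)\<^sup>2 - s * (norm u)\<^sup>2 - \<beta> * (norm v)\<^sup>2 - 1 / \<beta> * (norm w)\<^sup>2)"
  proof -
    have "2 * \<alpha> * - (v \<bullet> p) \<le> 2 * \<alpha> * ((s *\<^sub>R u - z) \<bullet> (X k - a) + \<beta> * (v \<bullet> (Y k - a))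
          + (1 / \<beta>) * (w \<bullet> (multiplier k - c)))"
      using key alpha by (intro mult_left_mono) auto
    moreover have "\<alpha> * (s * (norm ((1 / s) *\<^sub>R z))\<^sup>2 - s * (norm u)\<^sup>2 - \<beta> * (norm v)\<^sup>2 - 1 / \<beta> * (norm w)\<^sup>2)
      \<le> \<alpha> * ((L + \<beta>)\<^sup>2 / s * (norm u)\<^sup>2 - s * (norm u)\<^sup>2 - \<beta> * (norm v)\<^sup>2 - 1 / \<beta> * (norm w)\<^sup>2)"
      using z alpha by (intro mult_left_mono) auto
    ultimately show ?thesis unfolding sz by linarith
  qed
  also have "\<dots> \<le> dist_G a c k - \<alpha> * gap k + 2 * \<alpha> / \<beta> * (norm p)\<^sup>2"
  proof -
    have "\<alpha> * (2 * (v \<bullet> p)) \<le> \<alpha> * (\<beta> / 2 * (norm v)\<^sup>2 + 2 / \<beta> * (norm p)\<^sup>2)"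
      using vp alpha by (intro mult_left_mono) auto
    then show ?thesis
      unfolding gap_def u_def[symmetric] v_def[symmetric] w_def[symmetric]
      by (simp add: algebra_simps)
  qed
  finally show ?thesis .
qed

section \<open>Lyapunov function, accumulation points and convergence\<close>

lemma dist_G_nonneg: "0 \<le> dist_G a c k"
  unfolding dist_G_def using s_pos beta_pos by simp

lemma gap_nonneg: "0 \<le> gap k"
  unfolding gap_def using gap_coeff_pos beta_pos by simp

text \<open>The Fejer error is \<open>\<alpha> * e k\<close>, and \<open>e\<close> decays by
  \<open>(1 - \<alpha>)\<^sup>2 \<le> 1 - \<alpha>\<close>, so
  \<open>e (Suc k) + \<alpha> * e k \<le> e k\<close>. One \<open>e\<close> serves all solutions,
  which permits changing the reference solution later.\<close>

lemma lyapunov: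
  obtains e where "e \<longlonglongrightarrow> 0" "\<And>k. 0 \<le> e k"
    "\<And>a c k. multiplier_solution a c \<Longrightarrow>
       dist_G a c (Suc k) + e (Suc k) + \<alpha> * gap k \<le> dist_G a c k + e k"
proof -
  obtain p where p: "\<And>k b. b \<in> N \<Longrightarrow> (l k - (1 - \<alpha>) ^ k *\<^sub>R p) \<bullet> b = 0"
    using l_mod_orth by blast
  define e where "e k = 2 / \<beta> * ((1 - \<alpha>) ^ k * norm p)\<^sup>2" for k
  have "(\<lambda>k. 2 / \<beta> * ((1 - \<alpha>) ^ k * norm p)\<^sup>2) \<longlonglongrightarrow> 2 / \<beta> * (0 * norm p)\<^sup>2"
    using alpha by (intro tendsto_intros LIMSEQ_power_zero) auto
  then have "e \<longlonglongrightarrow> 0" by (simp add: e_def[abs_def])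
  moreover have "0 \<le> e k" for k using beta_pos by (simp add: e_def)
  moreover have "dist_G a c (Suc k) + e (Suc k) + \<alpha> * gap k \<le> dist_G a c k + e k"
    if "multiplier_solution a c" for a c k
  proof -
    have "dist_G a c (Suc k) \<le> dist_G a c k - \<alpha> * gap k + \<alpha> * e k"
      using fejer[OF that p] alpha by (simp add: e_def power_mult_distrib algebra_simps)
    moreover have "e (Suc k) = (1 - \<alpha>)\<^sup>2 * e k"
      by (simp add: e_def power_mult_distrib)
    moreover have "(1 - \<alpha>)\<^sup>2 * e k \<le> (1 - \<alpha>) * e k"
      using alpha \<open>0 \<le> e k\<close> by (intro mult_right_mono) (auto simp: power2_eq_square mult_left_le)
    ultimately show ?thesis by (simp add: algebra_simps)
  qed
  ultimately show thesis using that by blast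
qed

lemma square_tendsto_zero:
  fixes g :: "nat \<Rightarrow> 'a"
  assumes "f \<longlonglongrightarrow> 0" "0 < t" "\<And>k. t * (norm (g k))\<^sup>2 \<le> f k"
  shows "g \<longlonglongrightarrow> 0"
proof -
  have "(\<lambda>k. f k / t) \<longlonglongrightarrow> 0" using tendsto_divide[OF assms(1) tendsto_const, of t] assms(2) by simp
  then have "(\<lambda>k. (norm (g k))\<^sup>2) \<longlonglongrightarrow> 0"
    by (rule tendsto_sandwich[OF _ _ tendsto_const, rotated 2])
      (use assms in \<open>auto simp: field_simps\<close>)
  then have "(\<lambda>k. sqrt ((norm (g k))\<^sup>2)) \<longlonglongrightarrow> sqrt 0" by (rule tendsto_real_sqrt)
  then show ?thesis by (simp add: tendsto_norm_zero_iff)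
qed

lemma F_continuous: "continuous_on UNIV F"
  by (rule lipschitz_on_continuous_on[of L])
    (use lipschitz L_nonneg in \<open>auto simp: lipschitz_on_def dist_norm\<close>)

lemma dist_G_tendsto:
  assumes "(\<lambda>k. dist_G a c (h k)) \<longlonglongrightarrow> 0"
  shows "(\<lambda>k. x (h k)) \<longlonglongrightarrow> a" "(\<lambda>k. y (h k)) \<longlonglongrightarrow> a" "(\<lambda>k. l (h k)) \<longlonglongrightarrow> c"
proof -
  have "(\<lambda>k. x (h k) - a) \<longlonglongrightarrow> 0"
    by (rule square_tendsto_zero[OF assms s_pos]) (use s_pos beta_pos in \<open>auto simp: dist_G_def\<close>)
  moreover have "(\<lambda>k. y (h k) - a) \<longlonglongrightarrow> 0"
    by (rule square_tendsto_zero[OF assms beta_pos]) (use s_pos beta_pos in \<open>auto simp: dist_G_def\<close>)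
  moreover have "(\<lambda>k. l (h k) - c) \<longlonglongrightarrow> 0"
    by (rule square_tendsto_zero[OF assms, of "1 / \<beta>"]) (use s_pos beta_pos in \<open>auto simp: dist_G_def\<close>)
  ultimately show "(\<lambda>k. x (h k)) \<longlonglongrightarrow> a" "(\<lambda>k. y (h k)) \<longlonglongrightarrow> a" "(\<lambda>k. l (h k)) \<longlonglongrightarrow> c"
    by (simp_all add: Lim_null[symmetric])
qed

text \<open>A vanishing gap gives the predictions the same limits as the iterates. Then
  \<open>l - multiplier\<close>, which is \<open>\<beta> *\<^sub>R (X - Y)\<close>, forces
  \<open>a = b\<close>, and the residual in \<open>X_var'\<close> vanishes in the limit by
  continuity of \<open>F\<close>.\<close>

lemma accumulation_solution:
  assumes gap: "gap \<longlonglongrightarrow> 0" and h: "strict_mono h"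
    and lim: "(\<lambda>k. x (h k)) \<longlonglongrightarrow> a" "(\<lambda>k. y (h k)) \<longlonglongrightarrow> b" "(\<lambda>k. l (h k)) \<longlonglongrightarrow> c"
  shows "b = a" "multiplier_solution a c"
proof -
  have "(\<lambda>k. x k - X k) \<longlonglongrightarrow> 0"
    by (rule square_tendsto_zero[OF gap gap_coeff_pos])
      (use gap_coeff_pos beta_pos in \<open>auto simp: gap_def\<close>)
  from LIMSEQ_subseq_LIMSEQ[OF this h] have u: "(\<lambda>k. x (h k) - X (h k)) \<longlonglongrightarrow> 0" by (simp add: o_def)
  have "(\<lambda>k. y k - Y k) \<longlonglongrightarrow> 0"
    by (rule square_tendsto_zero[OF gap, of "\<beta> / 2"])
      (use gap_coeff_pos beta_pos in \<open>auto simp: gap_def\<close>)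
  from LIMSEQ_subseq_LIMSEQ[OF this h] have v: "(\<lambda>k. y (h k) - Y (h k)) \<longlonglongrightarrow> 0" by (simp add: o_def)
  have "(\<lambda>k. l k - multiplier k) \<longlonglongrightarrow> 0"
    by (rule square_tendsto_zero[OF gap, of "1 / \<beta>"])
      (use gap_coeff_pos beta_pos in \<open>auto simp: gap_def\<close>)
  from LIMSEQ_subseq_LIMSEQ[OF this h] have w: "(\<lambda>k. l (h k) - multiplier (h k)) \<longlonglongrightarrow> 0" by (simp add: o_def)
  have X: "(\<lambda>k. X (h k)) \<longlonglongrightarrow> a" using tendsto_diff[OF lim(1) u] by simp
  have Y: "(\<lambda>k. Y (h k)) \<longlonglongrightarrow> b" using tendsto_diff[OF lim(2) v] by simp
  have M: "(\<lambda>k. multiplier (h k)) \<longlonglongrightarrow> c" using tendsto_diff[OF lim(3) w] by simp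
  have "(\<lambda>k. \<beta> *\<^sub>R (X (h k) - Y (h k))) \<longlonglongrightarrow> \<beta> *\<^sub>R (a - b)"
    by (intro tendsto_intros X Y)
  moreover have "(\<lambda>k. \<beta> *\<^sub>R (X (h k) - Y (h k))) \<longlonglongrightarrow> 0"
    using w by (simp add: multiplier_def)
  ultimately have "\<beta> *\<^sub>R (a - b) = 0" by (rule LIMSEQ_unique)
  then show ba: "b = a" using beta_pos by simp
  have aC: "a \<in> C" using closed_sequentially[OF closed_C _ X] X_in by simp
  have aN: "a \<in> N" using closed_sequentially[OF closed_subspace[OF subspace_N] _ Y] Y_in ba by simp
  have Fx: "(\<lambda>k. F (x (h k))) \<longlonglongrightarrow> F a" and FX: "(\<lambda>k. F (X (h k))) \<longlonglongrightarrow> F a"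
    using continuous_on_tendsto_compose[OF F_continuous _ UNIV_I] lim(1) X by auto
  have "0 \<le> (F a - c) \<bullet> (a' - a)" if a': "a' \<in> C" for a'
  proof -
    have "(\<lambda>k. (F (X (h k)) - multiplier (h k)
        - (s *\<^sub>R (x (h k) - X (h k)) - (F (x (h k)) - F (X (h k)) + \<beta> *\<^sub>R (x (h k) - X (h k))))
        - \<beta> *\<^sub>R (y (h k) - Y (h k))) \<bullet> (a' - X (h k)))
      \<longlonglongrightarrow> (F a - c - (s *\<^sub>R 0 - (F a - F a + \<beta> *\<^sub>R 0)) - \<beta> *\<^sub>R 0) \<bullet> (a' - a)"
      by (intro tendsto_intros X M u v Fx FX)
    from LIMSEQ_le_const[OF this] X_var'[OF a'] show ?thesis by simp
  qed
  moreover have "0 \<le> c \<bullet> (b' - a)" if "b' \<in> N" for b'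
  proof -
    have "(\<lambda>k. multiplier (h k) \<bullet> (b' - a)) \<longlonglongrightarrow> c \<bullet> (b' - a)" by (intro tendsto_intros M)
    moreover have "multiplier (h k) \<bullet> (b' - a) = 0" for k
      by (intro multiplier_orth subspace_diff subspace_N that aN)
    ultimately show ?thesis by (simp add: LIMSEQ_const_iff)
  qed
  ultimately show "multiplier_solution a c" using aC aN by (simp add: multiplier_solution_def)
qed

theorem converges:
  assumes "multiplier_solution a0 c0"
  obtains a c where "multiplier_solution a c" "x \<longlonglongrightarrow> a" "y \<longlonglongrightarrow> a" "l \<longlonglongrightarrow> c"
proof -
  obtain e where e: "e \<longlonglongrightarrow> 0" "\<And>k. 0 \<le> e k"
    and lyap: "\<And>a c k. multiplier_solution a c \<Longrightarrow>
       dist_G a c (Suc k) + e (Suc k) + \<alpha> * gap k \<le> dist_G a c k + e k"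
    using lyapunov by blast
  have dec: "decseq (\<lambda>k. dist_G a c k + e k)" if "multiplier_solution a c" for a c
  proof (rule decseq_SucI)
    fix k
    have "0 \<le> \<alpha> * gap k" using alpha gap_nonneg by simp
    then show "dist_G a c (Suc k) + e (Suc k) \<le> dist_G a c k + e k"
      using lyap[OF that, of k] by linarith
  qed
  define V where "V k = dist_G a0 c0 k + e k" for k
  have V_dec: "decseq V" using dec[OF assms] by (simp add: V_def[abs_def])
  have V_nonneg: "0 \<le> V k" for k using dist_G_nonneg e(2) by (simp add: V_def)
  obtain V' where V': "V \<longlonglongrightarrow> V'" using decseq_convergent[OF V_dec] V_nonneg by metis
  \<comment> \<open>The gap is dominated by consecutive differences of a convergent
    sequence.\<close>
  have "(\<lambda>k. (V k - V (Suc k)) / \<alpha>) \<longlonglongrightarrow> (V' - V') / \<alpha>"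
    using alpha by (intro tendsto_intros V' LIMSEQ_Suc[OF V']) auto
  then have "(\<lambda>k. (V k - V (Suc k)) / \<alpha>) \<longlonglongrightarrow> 0" by simp
  then have gap: "gap \<longlonglongrightarrow> 0"
  proof (rule tendsto_sandwich[OF _ _ tendsto_const, rotated 2])
    show "\<forall>\<^sub>F k in sequentially. 0 \<le> gap k"
      by (simp add: gap_nonneg)
    have "gap k \<le> (V k - V (Suc k)) / \<alpha>" for k
      using lyap[OF assms, of k] alpha by (simp add: V_def field_simps)
    then show "\<forall>\<^sub>F k in sequentially. gap k \<le> (V k - V (Suc k)) / \<alpha>" by simp
  qed
  have bd: "dist_G a0 c0 k \<le> V 0" for k
    using decseqD[OF V_dec, of 0 k] e(2)[of k] by (simp add: V_def)
  have term_le: "norm b \<le> sqrt (V 0 / t)" if "t * (norm b)\<^sup>2 \<le> V 0" "0 < t" for b :: 'a and t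
    using that by (intro real_le_rsqrt) (simp add: field_simps)
  have "norm (x k - a0) \<le> sqrt (V 0 / s)" "norm (y k - a0) \<le> sqrt (V 0 / \<beta>)"
    "norm (l k - c0) \<le> sqrt (V 0 / (1 / \<beta>))" for k
    by (rule term_le; use bd[of k] s_pos beta_pos in
      \<open>auto simp: dist_G_def intro: order_trans[rotated]\<close>)+
  then have "(x k, y k, l k) \<in> cball a0 (sqrt (V 0 / s)) \<times> cball a0 (sqrt (V 0 / \<beta>))
      \<times> cball c0 (sqrt (V 0 / (1 / \<beta>)))" for k
    by (simp add: dist_norm norm_minus_commute)
  moreover have "compact (cball a0 (sqrt (V 0 / s)) \<times> cball a0 (sqrt (V 0 / \<beta>))
      \<times> cball c0 (sqrt (V 0 / (1 / \<beta>))))"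
    by (intro compact_Times compact_cball)
  ultimately obtain q h where h: "strict_mono (h::nat \<Rightarrow> nat)"
    and q: "((\<lambda>k. (x k, y k, l k)) \<circ> h) \<longlonglongrightarrow> q"
    unfolding compact_def by (metis (no_types, lifting))
  define a b c where "a = fst q" and "b = fst (snd q)" and "c = snd (snd q)"
  have lim: "(\<lambda>k. x (h k)) \<longlonglongrightarrow> a" "(\<lambda>k. y (h k)) \<longlonglongrightarrow> b" "(\<lambda>k. l (h k)) \<longlonglongrightarrow> c"
    using tendsto_fst[OF q] tendsto_fst[OF tendsto_snd[OF q]] tendsto_snd[OF tendsto_snd[OF q]]
    by (simp_all add: o_def a_def b_def c_def)
  note acc = accumulation_solution[OF gap h lim]
  \<comment> \<open>The accumulation point is itself a solution, so the Lyapunov function recentred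
    at it is decreasing too; its limit is zero because it is zero along the subsequence.\<close>
  define W where "W k = dist_G a c k + e k" for k
  have W_dec: "decseq W" using dec[OF acc(2)] by (simp add: W_def[abs_def])
  have W_nonneg: "0 \<le> W k" for k using dist_G_nonneg e(2) by (simp add: W_def)
  obtain W' where W': "W \<longlonglongrightarrow> W'" using decseq_convergent[OF W_dec] W_nonneg by metis
  have "(\<lambda>k. s * (norm (x (h k) - a))\<^sup>2 + \<beta> * (norm (y (h k) - a))\<^sup>2
        + 1 / \<beta> * (norm (l (h k) - c))\<^sup>2 + e (h k))
      \<longlonglongrightarrow> s * (norm (a - a))\<^sup>2 + \<beta> * (norm (a - a))\<^sup>2 + 1 / \<beta> * (norm (c - c))\<^sup>2 + 0"
    using LIMSEQ_subseq_LIMSEQ[OF e(1) h] lim unfolding acc(1) o_def by (intro tendsto_intros)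
  then have "(\<lambda>k. W (h k)) \<longlonglongrightarrow> 0" by (simp add: W_def dist_G_def)
  moreover have "(\<lambda>k. W (h k)) \<longlonglongrightarrow> W'" using LIMSEQ_subseq_LIMSEQ[OF W' h] by (simp add: o_def)
  ultimately have "W' = 0" using LIMSEQ_unique by blast
  then have "(\<lambda>k. W k - e k) \<longlonglongrightarrow> 0" using tendsto_diff[OF W' e(1)] by simp
  then have "(\<lambda>k. dist_G a c k) \<longlonglongrightarrow> 0" by (simp add: W_def)
  from dist_G_tendsto[OF this] acc(2) show thesis using that by blast
qed

end

section \<open>Transport of the weighted inner product to the Euclidean one\<close>

text \<open>Square roots of the probabilities make this an isometry from the weighted inner product
  to the built-in one; positivity of \<open>P\<close> makes it invertible.\<close>

definition weight :: "'w::finite pmf \<Rightarrow> real^'n^'w \<Rightarrow> real^'n^'w" where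
  "weight P x = (\<chi> \<omega>. sqrt (pmf P \<omega>) *\<^sub>R x $ \<omega>)"

definition unweight :: "'w::finite pmf \<Rightarrow> real^'n^'w \<Rightarrow> real^'n^'w" where
  "unweight P x = (\<chi> \<omega>. (1 / sqrt (pmf P \<omega>)) *\<^sub>R x $ \<omega>)"

lemma linear_weight: "linear (weight P)"
  by (rule linearI) (auto simp: weight_def vec_eq_iff algebra_simps)

lemmas weight_add = linear_add[OF linear_weight]
  and weight_diff = linear_diff[OF linear_weight]
  and weight_scaleR = linear_scale[OF linear_weight]
  and weight_zero = linear_0[OF linear_weight]

lemmas weight_simps = weight_add weight_diff weight_scaleR weight_zero

lemma L2_inner_weight: "L2_inner P x y = weight P x \<bullet> weight P y"
proof -
  have "L2_inner P x y = (\<Sum>\<omega>\<in>UNIV. pmf P \<omega> *\<^sub>R (x $ \<omega> \<bullet> y $ \<omega>))"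
    unfolding L2_inner_def by (rule integral_measure_pmf) auto
  also have "\<dots> = weight P x \<bullet> weight P y"
    unfolding inner_vec_def[of "weight P x"] by (intro sum.cong refl) (simp add: weight_def)
  finally show ?thesis .
qed

lemma L2_norm_weight: "L2_norm P x = norm (weight P x)"
  by (simp add: L2_norm_def L2_inner_weight norm_eq_sqrt_inner)

context
  fixes P :: "'w::finite pmf"
  assumes P_pos: "\<And>\<omega>. pmf P \<omega> > 0"
begin

lemma weight_unweight [simp]: "weight P (unweight P x) = x"
proof -
  have "sqrt (pmf P \<omega>) \<noteq> 0" for \<omega> using P_pos[of \<omega>] by simp
  then show ?thesis by (simp add: weight_def unweight_def vec_eq_iff)
qed

lemma unweight_weight [simp]: "unweight P (weight P x) = x"
proof -
  have "sqrt (pmf P \<omega>) \<noteq> 0" for \<omega> using P_pos[of \<omega>] by simp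
  then show ?thesis by (simp add: weight_def unweight_def vec_eq_iff)
qed

lemma inj_weight: "inj (weight P)"
  by (metis injI unweight_weight)

lemma weight_in_image_iff [simp]: "weight P x \<in> weight P ` S \<longleftrightarrow> x \<in> S"
  by (rule inj_image_mem_iff[OF inj_weight])

text \<open>The isometry carries \<open>S\<close> to a closed convex set, whose Euclidean closest
  point pulls back to a minimizer. This existence is what gives the choice in \<open>L2_proj\<close>
  its meaning; the inequality is the obtuse angle property of closest points.\<close>

lemma L2_proj_variational:
  fixes S :: "(real^'n::finite^'w) set"
  assumes "closed S" "convex S" "S \<noteq> {}"
  shows "L2_proj P S u \<in> S"
    and "z \<in> S \<Longrightarrow> 0 \<le> L2_inner P (L2_proj P S u - u) (z - L2_proj P S u)"
proof -
  let ?W = "weight P ` S" and ?p = "L2_proj P S u"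
  have W: "closed ?W" "convex ?W" "?W \<noteq> {}"
    by (rule closed_injective_linear_image[OF assms(1) linear_weight inj_weight],
        rule convex_linear_image[OF linear_weight assms(2)], use assms(3) in blast)
  obtain p where p: "p \<in> S" "closest_point ?W (weight P u) = weight P p"
    using closest_point_in_set[OF W(1,3)] by blast
  have "L2_norm P (u - p) \<le> L2_norm P (u - y)" if "y \<in> S" for y
    using closest_point_le[OF W(1) imageI[OF that, of "weight P"], of "weight P u"]
    by (simp add: p(2) L2_norm_weight weight_diff dist_norm)
  with p(1) have "\<exists>p. p \<in> S \<and> (\<forall>y\<in>S. L2_norm P (u - p) \<le> L2_norm P (u - y))" by blast
  then have p: "?p \<in> S \<and> (\<forall>y\<in>S. L2_norm P (u - ?p) \<le> L2_norm P (u - y))"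
    unfolding L2_proj_def by (rule someI_ex)
  then show "?p \<in> S" by blast
  assume "z \<in> S"
  have "(weight P u - weight P ?p) \<bullet> (weight P z - weight P ?p) \<le> 0"
  proof (rule any_closest_point_dot[OF W(2,1)])
    show "\<forall>z\<in>?W. dist (weight P u) (weight P ?p) \<le> dist (weight P u) z"
      using p unfolding L2_norm_weight weight_diff dist_norm by blast
  qed (use p \<open>z \<in> S\<close> in blast)+
  then show "0 \<le> L2_inner P (?p - u) (z - ?p)"
    by (simp add: L2_inner_weight weight_diff inner_diff_left)
qed

section \<open>The variational inequality on the product set and its multiplier form\<close>

lemma VI_solution_iff:
  "VI_solution P (T_op F) (CC \<times> NN \<times> UNIV) (a, b, c) \<longleftrightarrow>
     b = a \<and> a \<in> CC \<and> a \<in> NN \<and> (\<forall>z\<in>CC. 0 \<le> L2_inner P (F a - c) (z - a))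
     \<and> (\<forall>z\<in>NN. 0 \<le> L2_inner P c (z - a))" (is "?lhs \<longleftrightarrow> ?rhs")
proof
  assume ?lhs
  then have mem: "a \<in> CC" "b \<in> NN"
    and var: "\<And>a' b' c'. a' \<in> CC \<Longrightarrow> b' \<in> NN \<Longrightarrow>
      0 \<le> L2_inner P (F a - c) (a' - a) + L2_inner P c (b' - b) + L2_inner P (a - b) (c' - c)"
    by (auto simp: VI_solution_def T_op_def L2_inner3_def)
  \<comment> \<open>The third component is unconstrained, so \<open>c\<close> may be moved against
    \<open>a - b\<close>.\<close>
  have "0 \<le> - (weight P (a - b) \<bullet> weight P (a - b))"
    using var[OF mem, of "c - (a - b)"]
    by (simp add: L2_inner_weight weight_simps inner_diff_left inner_diff_right)
  then have "weight P (a - b) = 0"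
    by (metis inner_eq_zero_iff inner_ge_zero neg_0_le_iff_le order_antisym)
  then have ba: "b = a"
    by (metis eq_iff_diff_eq_0 unweight_weight weight_zero)
  show ?rhs
    using mem var[of _ b c] var[of a _ c] by (auto simp: ba L2_inner_weight weight_simps)
next
  assume ?rhs
  then show ?lhs
    by (auto simp: VI_solution_def T_op_def L2_inner3_def L2_inner_weight weight_simps)
qed

text \<open>For a test point in both sets the two inequalities can be added, and the multiplier
  cancels.\<close>

lemma VI_solution_MSVI:
  assumes "VI_solution P (T_op F) (CC \<times> NN \<times> UNIV) (a, b, c)"
  shows "MSVI_solution P F (CC \<inter> NN) a"
  unfolding MSVI_solution_def normal_cone_def
proof (intro conjI CollectI ballI)
  show "a \<in> CC \<inter> NN" using assms by (simp add: VI_solution_iff)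
  fix z assume "z \<in> CC \<inter> NN"
  then have "0 \<le> L2_inner P (F a - c) (z - a) + L2_inner P c (z - a)"
    using assms by (intro add_nonneg_nonneg) (auto simp: VI_solution_iff)
  then show "L2_inner P (- F a) (z - a) \<le> 0"
    by (simp add: L2_inner_weight weight_simps linear_neg[OF linear_weight] inner_diff_left)
qed

end

section \<open>The constraint sets and the inverse of the metric operator\<close>

lemma linear_block: "linear (block stage i)"
  by (rule linearI) (auto simp: block_def vec_eq_iff)

lemma linear_block_nth: "linear (\<lambda>x :: real^'n^'w. block stage i (x $ \<omega>))"
  by (rule linearI) (simp_all add: linear_add[OF linear_block] linear_scale[OF linear_block])

text \<open>As an intersection of linear preimages, the set inherits closedness and convexity from
  the values of \<open>C\<close>.\<close>

lemma constr_eq: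
  "constr C N stage = (\<Inter>\<omega>. \<Inter>i\<in>{..<N}. (\<lambda>x. block stage i (x $ \<omega>)) -` C i \<omega>)"
  by (auto simp: constr_def)

lemma closed_constr:
  assumes "\<And>i \<omega>. i < N \<Longrightarrow> closed (C i \<omega>)"
  shows "closed (constr C N stage)"
  unfolding constr_eq
  by (intro closed_INT ballI closed_vimage assms linear_continuous_on
      linear_conv_bounded_linear[THEN iffD1] linear_block_nth) auto

lemma convex_constr:
  assumes "\<And>i \<omega>. i < N \<Longrightarrow> convex (C i \<omega>)"
  shows "convex (constr C N stage)"
  unfolding constr_eq
  by (intro convex_INT convex_linear_vimage linear_block_nth assms) auto

lemma subspace_nonanticip: "subspace (nonanticip m \<xi> N stage)"
  unfolding subspace_def nonanticip_def
  by (auto simp: linear_add[OF linear_block] linear_scale[OF linear_block] linear_0[OF linear_block]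
      intro!: borel_measurable_add borel_measurable_scaleR)

lemma inv_G_op:
  assumes "\<beta> > 0" "r > 0"
  shows "inv (G_op \<beta> r) (u, v, w) = ((1 / (\<beta> * r)) *\<^sub>R u, (1 / \<beta>) *\<^sub>R v, \<beta> *\<^sub>R w)"
  using assms by (intro inv_f_eq) (auto simp: G_op_def inj_def)

section \<open>Convergence of the prediction-correction iteration\<close>

theorem theorem4p1:
  fixes P :: "'w::finite pmf"
    and N :: nat
    and m :: "nat \<Rightarrow> nat"
    and \<xi> :: "nat \<Rightarrow> 'w \<Rightarrow> nat \<Rightarrow> real"
    and stage :: "'n::finite \<Rightarrow> nat"
    and C :: "nat \<Rightarrow> 'w \<Rightarrow> (real^'n) set"
    and F :: "real^'n^'w \<Rightarrow> real^'n^'w"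
    and L\<^sub>F \<beta> r \<alpha> :: real
    and CC NN :: "(real^'n^'w) set"
    and K :: "('n, 'w) triple set"
    and \<theta> :: "nat \<Rightarrow> ('n, 'w) triple"
  defines "CC \<equiv> constr C N stage"
    and "NN \<equiv> nonanticip m \<xi> N stage"
    and "K \<equiv> CC \<times> NN \<times> UNIV"
  assumes P_pos: "\<And>\<omega>. pmf P \<omega> > 0"
    and xi_random: "\<And>j. 1 \<le> j \<Longrightarrow> j < N \<Longrightarrow> \<xi> j \<in> measure_pmf P \<rightarrow>\<^sub>M (\<Pi>\<^sub>M l\<in>{..<m j}. borel)"
    and stage_less: "\<And>j. stage j < N"
    and C_block: "\<And>i \<omega>. i < N \<Longrightarrow> C i \<omega> \<subseteq> block_space stage i"
    and C_nonempty: "\<And>i \<omega>. i < N \<Longrightarrow> C i \<omega> \<noteq> {}"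
    and C_closed: "\<And>i \<omega>. i < N \<Longrightarrow> closed (C i \<omega>)"
    and C_convex: "\<And>i \<omega>. i < N \<Longrightarrow> convex (C i \<omega>)"
    and C_measurable: "\<And>i. i < N \<Longrightarrow> measurable_setmap (filtr m \<xi> i) (C i)"
    and F_monotone: "L2_monotone P F"
    and L_pos: "L\<^sub>F > 0"
    and F_lipschitz: "L2_lipschitz P L\<^sub>F F"
    and VI_solvable: "\<exists>\<theta>s. VI_solution P (T_op F) K \<theta>s"
    and beta_pos: "\<beta> > 0"
    and r_large: "r > L\<^sub>F / \<beta> + 1"
    and alpha: "0 < \<alpha>" "\<alpha> < 1"
    and start: "\<theta> 0 \<in> K"
    and iterates: "\<And>k. \<theta> (Suc k) = PC_ADMM_step P F CC NN \<beta> r \<alpha> (\<theta> k)"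
  shows "(\<exists>\<theta>s. VI_solution P (T_op F) K \<theta>s \<and> (\<lambda>k. L2_norm3 P (\<theta> k - \<theta>s)) \<longlonglongrightarrow> 0)
       \<and> (\<exists>xs. MSVI_solution P F (CC \<inter> NN) xs \<and> (\<lambda>k. L2_norm P (fst (\<theta> k) - xs)) \<longlonglongrightarrow> 0)"
proof -
  have s_large: "L\<^sub>F + \<beta> < \<beta> * r"
    using r_large beta_pos by (simp add: field_simps)
  have r_pos: "r > 0"
    using r_large divide_pos_pos[OF L_pos beta_pos] by linarith
  have CC: "closed CC" "convex CC" "CC \<noteq> {}"
    using VI_solvable closed_constr[OF C_closed] convex_constr[OF C_convex]
    by (auto simp: CC_def K_def VI_solution_def)
  have NN: "subspace NN" by (simp add: NN_def subspace_nonanticip)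
  have NN_nonempty: "NN \<noteq> {}" using subspace_0[OF NN] by blast
  note NN' = closed_subspace[OF NN] subspace_imp_convex[OF NN] NN_nonempty
  define x y l where "x k = fst (\<theta> k)" and "y k = fst (snd (\<theta> k))" and "l k = snd (snd (\<theta> k))" for k
  define X where "X k = L2_proj P CC (x k - (1 / (\<beta> * r)) *\<^sub>R (F (x k) - l k + \<beta> *\<^sub>R (x k - y k)))" for k
  define Y where "Y k = L2_proj P NN (y k - (1 / \<beta>) *\<^sub>R (l k - \<beta> *\<^sub>R (X k - y k)))" for k
  have theta: "\<theta> k = (x k, y k, l k)" for k by (simp add: x_def y_def l_def)
  have pred: "prediction P F CC NN \<beta> r (x k, y k, l k) = (X k, Y k, l k - \<beta> *\<^sub>R (X k - Y k))" for k
    unfolding prediction_def X_def Y_def Let_def prod.case by (rule refl)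
  have "\<theta> (Suc k) = (x k, y k, l k) - \<alpha> *\<^sub>R ((x k, y k, l k) - (X k, Y k, l k - \<beta> *\<^sub>R (X k - Y k))
      - ((1 / (\<beta> * r)) *\<^sub>R (F (x k) - F (X k) + \<beta> *\<^sub>R (x k - X k)), 0, 0))" for k
    unfolding iterates theta[of k] PC_ADMM_step_def Let_def pred direction_def zeta_def fst_conv
      inv_G_op[OF beta_pos r_pos] scaleR_zero_right by (rule refl)
  then have steps: "x (Suc k) = x k - \<alpha> *\<^sub>R (x k - X k
        - (1 / (\<beta> * r)) *\<^sub>R (F (x k) - F (X k) + \<beta> *\<^sub>R (x k - X k)))"
    "y (Suc k) = y k - \<alpha> *\<^sub>R (y k - Y k)"
    "l (Suc k) = l k - \<alpha> *\<^sub>R (\<beta> *\<^sub>R (X k - Y k))" for k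
    unfolding x_def[of "Suc k"] y_def[of "Suc k"] l_def[of "Suc k"] by simp_all
  let ?w = "weight P" and ?F = "\<lambda>a. weight P (F (unweight P a))"
  note [simp] = weight_unweight[OF P_pos] unweight_weight[OF P_pos] weight_in_image_iff[OF P_pos]
  have X_var: "0 \<le> (?w (X k) - ?w (x k) + (1 / (\<beta> * r)) *\<^sub>R (?w (F (x k)) - ?w (l k)
      + \<beta> *\<^sub>R (?w (x k) - ?w (y k)))) \<bullet> (?w z - ?w (X k))" if "z \<in> CC" for z k
    using L2_proj_variational(2)[OF P_pos CC that,
        of "x k - (1 / (\<beta> * r)) *\<^sub>R (F (x k) - l k + \<beta> *\<^sub>R (x k - y k))"]
    unfolding X_def[symmetric] L2_inner_weight weight_simps
    by (simp only: diff_diff_eq2 add_diff_eq diff_add_eq)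
  have Y_var: "0 \<le> (?w (Y k) - ?w (y k) + (1 / \<beta>) *\<^sub>R (?w (l k)
      - \<beta> *\<^sub>R (?w (X k) - ?w (y k)))) \<bullet> (?w z - ?w (Y k))" if "z \<in> NN" for z k
    using L2_proj_variational(2)[OF P_pos NN' that,
        of "y k - (1 / \<beta>) *\<^sub>R (l k - \<beta> *\<^sub>R (X k - y k))"]
    unfolding Y_def[symmetric] L2_inner_weight weight_simps
    by (simp only: diff_diff_eq2 add_diff_eq diff_add_eq)
  \<comment> \<open>All data are moved through the isometry, with \<open>F\<close> conjugated by it,
    so that monotonicity and the Lipschitz bound become Euclidean with the same constant.\<close>
  interpret pc_admm "?w ` CC" "?w ` NN" ?F L\<^sub>F \<beta> "\<beta> * r" \<alpha>
    "\<lambda>k. ?w (x k)" "\<lambda>k. ?w (y k)" "\<lambda>k. ?w (l k)" "\<lambda>k. ?w (X k)" "\<lambda>k. ?w (Y k)"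
  proof
    show "closed (?w ` CC)"
      by (rule closed_injective_linear_image[OF CC(1) linear_weight inj_weight[OF P_pos]])
    show "subspace (?w ` NN)" by (rule linear_subspace_image[OF linear_weight NN])
    show "0 \<le> (?F a - ?F b) \<bullet> (a - b)" for a b
      using F_monotone[unfolded L2_monotone_def, rule_format, of "unweight P a" "unweight P b"]
      by (simp add: L2_inner_weight weight_simps)
    show "norm (?F a - ?F b) \<le> L\<^sub>F * norm (a - b)" for a b
      using F_lipschitz[unfolded L2_lipschitz_def, rule_format, of "unweight P a" "unweight P b"]
      by (simp add: L2_norm_weight weight_simps)
    show "?w (y 0) \<in> ?w ` NN" using start by (simp add: theta K_def)
    show "?w (X k) \<in> ?w ` CC" for k
      unfolding X_def using L2_proj_variational(1)[OF P_pos CC] by simp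
    show "?w (Y k) \<in> ?w ` NN" for k
      unfolding Y_def using L2_proj_variational(1)[OF P_pos NN'] by simp
    show "0 \<le> ((\<beta> * r) *\<^sub>R (?w (X k) - ?w (x k)) + (?F (?w (x k)) - ?w (l k)
      + \<beta> *\<^sub>R (?w (x k) - ?w (y k)))) \<bullet> (a - ?w (X k))" if a: "a \<in> ?w ` CC" for a k
    proof -
      obtain z where z: "z \<in> CC" "a = ?w z" using a by blast
      have eq: "(\<beta> * r) *\<^sub>R p + q = (\<beta> * r) *\<^sub>R (p + (1 / (\<beta> * r)) *\<^sub>R q)" for p q :: "real^'n^'w"
        using beta_pos r_pos by (simp add: scaleR_right_distrib)
      have "0 \<le> \<beta> * r" using beta_pos r_pos by simp
      from mult_nonneg_nonneg[OF this X_var[OF z(1)]] show ?thesis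
        by (simp only: eq inner_scaleR_left z(2) unweight_weight[OF P_pos])
    qed
    show "0 \<le> (?w (l k) - \<beta> *\<^sub>R (?w (X k) - ?w (Y k))) \<bullet> (b - ?w (Y k))"
      if b: "b \<in> ?w ` NN" for b k
    proof -
      obtain z where z: "z \<in> NN" "b = ?w z" using b by blast
      \<comment> \<open>Scaling the projection inequality by \<open>\<beta>\<close> cancels
        \<open>y k\<close>, leaving the predicted multiplier.\<close>
      have eq: "?w (l k) - \<beta> *\<^sub>R (?w (X k) - ?w (Y k))
        = \<beta> *\<^sub>R (?w (Y k) - ?w (y k) + (1 / \<beta>) *\<^sub>R (?w (l k) - \<beta> *\<^sub>R (?w (X k) - ?w (y k))))"
        using beta_pos by (simp add: algebra_simps)
      from mult_nonneg_nonneg[OF less_imp_le[OF beta_pos] Y_var[OF z(1)]] show ?thesis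
        by (simp only: eq inner_scaleR_left z(2))
    qed
  qed (use alpha beta_pos L_pos s_large in \<open>simp_all add: steps weight_simps\<close>)
  have sol_iff: "multiplier_solution (?w a) (?w c) \<longleftrightarrow> VI_solution P (T_op F) K (a, a, c)" for a c
    unfolding multiplier_solution_def K_def
    by (simp add: VI_solution_iff[OF P_pos] L2_inner_weight weight_simps)
  obtain a0 b0 c0 where "VI_solution P (T_op F) K (a0, b0, c0)"
    using VI_solvable by (metis prod_cases3)
  then have "multiplier_solution (?w a0) (?w c0)"
    unfolding sol_iff by (simp add: K_def VI_solution_iff[OF P_pos])
  then obtain a' c' where a'c': "multiplier_solution a' c'"
    and lim: "(\<lambda>k. ?w (x k)) \<longlonglongrightarrow> a'" "(\<lambda>k. ?w (y k)) \<longlonglongrightarrow> a'" "(\<lambda>k. ?w (l k)) \<longlonglongrightarrow> c'"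
    using converges by blast
  define a c where "a = unweight P a'" and "c = unweight P c'"
  have sol: "VI_solution P (T_op F) K (a, a, c)"
    using a'c' sol_iff[of a c] by (simp add: a_def c_def)
  \<comment> \<open>The weighted norms are Euclidean norms of the transported differences, so the
    limits carry back unchanged.\<close>
  have norms: "L2_norm P (x k - a) = norm (?w (x k) - a')"
    "L2_norm3 P (\<theta> k - (a, a, c)) = sqrt ((norm (?w (x k) - a'))\<^sup>2 + (norm (?w (y k) - a'))\<^sup>2
      + (norm (?w (l k) - c'))\<^sup>2)" for k
    by (simp_all add: a_def c_def L2_norm3_def L2_inner3_def theta L2_norm_weight L2_inner_weight
        weight_simps power2_norm_eq_inner)
  have "(\<lambda>k. L2_norm3 P (\<theta> k - (a, a, c))) \<longlonglongrightarrow>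
      sqrt ((norm (a' - a'))\<^sup>2 + (norm (a' - a'))\<^sup>2 + (norm (c' - c'))\<^sup>2)"
    unfolding norms by (intro tendsto_intros lim)
  then have 1: "(\<lambda>k. L2_norm3 P (\<theta> k - (a, a, c))) \<longlonglongrightarrow> 0" by simp
  have "(\<lambda>k. L2_norm P (x k - a)) \<longlonglongrightarrow> norm (a' - a')"
    unfolding norms by (intro tendsto_intros lim)
  then have 2: "(\<lambda>k. L2_norm P (fst (\<theta> k) - a)) \<longlonglongrightarrow> 0" by (simp add: x_def)
  have "MSVI_solution P F (CC \<inter> NN) a"
    using VI_solution_MSVI[OF P_pos] sol unfolding K_def by blast
  with sol 1 2 show ?thesis by blast
qed

end
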